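(* For $d \ge 2$, consider a continuous-time irreducible Markov chain with finite state space $\mathcal{X} = \{0,1,\dots,d\}$, generator $Q$, and stationary distribution $\pi$. Let $\mathfrak{F} : \mathcal{P} \to \mathbb{R}$ be a differentiable functional and $g$ a Riemannian metric on $\mathcal{P}$. If the flow associated to the semigroup $e^{tQ}$ equals the gradient flow of $\mathfrak{F}$ under the metric $g$, then for $\rho \in \mathcal{P}$ with $\rho \neq \pi$, there exists another metric $\tilde{g}$ on $\mathcal{P}$ such that $\tilde{g} \neq g$ at $\rho$ and such that the gradient flow of $\mathfrak{F}$ under the metric $\tilde{g}$ still equals the flow associated to the semigroup $e^{tQ}$.
   Context: The generator of a continuous-time Markov chain with state space $\mathcal{X}=\{0,1,\dots,d\}$ is the matrix $Q\in\mathbb{R}^{\mathcal{X}\times\mathcal{X}}$ where for $i\neq j$ the entry $Q_{ij}$ is the transition rate from state $i$ to state $j$, and $Q_{ii}=-\sum_{j\neq i}Q_{ij}$. Probability distributions are row vectors on which matrices act from the right: if the initial distribution is $\mu$, the distribution after time $t$ is $\mu e^{tQ}$. Since the chain is irreducible, there is a unique stationary distribution $\pi$, to which $\mu e^{tQ}$ converges as $t\to\infty$. $\mathcal{P}$ is the space of probability distributions on $\mathcal{X}$ with positive mass for any state, understood as the $d$-dimensional submanifold $\{v\in\mathbb{R}^{\mathcal{X}}:\sum_{i\in\mathcal{X}}v_i=1 \text{ and } v_i>0\ \forall i\in\mathcal{X}\}$ of $\mathbb{R}^{\mathcal{X}}$. Under this identification the tangent space at any point is $T=\{v\in\mathbb{R}^{\mathcal{X}}:\sum_{i\in\mathcal{X}}v_i=0\}$.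 For a Riemannian metric $g$ on $\mathcal{P}$, $g|_\mu$ denotes its value at $\mu\in\mathcal{P}$, an inner product on $T$. For a differentiable functional $\mathfrak{F}$, $\mathrm{d}\mathfrak{F}|_\mu : T\to\mathbb{R}$ denotes its first derivative at $\mu$. Given a functional $\mathfrak{F}:\mathcal{P}\to\mathbb{R}$ and a Riemannian metric $g$ on $\mathcal{P}$, the gradient flow $\rho:\mathbb{R}^+\to\mathcal{P}$ is determined by the differential equation $g|_{\rho(t)}(\dot\rho(t),v)=-\mathrm{d}\mathfrak{F}|_{\rho(t)}(v)$ for all $v\in T$, $t\in\mathbb{R}^+$. The gradient flow of $\mathfrak{F}$ under $g$ is said to equal the flow associated to the semigroup $e^{tQ}$ if for all $\mu\in\mathcal{P}$ the trajectory $t\mapsto\mu e^{tQ}$ equals the gradient flow $\rho(t)$ with $\rho(0)=\mu$. *)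

theory Defs
  imports "HOL-Analysis.Analysis"
begin

text \<open>
  The state space is a finite type \<open>'n\<close>. Distributions are row vectors in \<open>real ^ 'n\<close>, and a matrix
  \<open>A\<close> acts on them from the right by \<open>\<mu> v* A\<close>.
\<close>

section \<open>Markov chains\<close>

definition generator :: "real ^ 'n ^ 'n \<Rightarrow> bool" where
  "generator Q \<longleftrightarrow>
     (\<forall>i j. i \<noteq> j \<longrightarrow> 0 \<le> Q $ i $ j) \<and>
     (\<forall>i. Q $ i $ i = - (\<Sum>j \<in> UNIV - {i}. Q $ i $ j))"

definition irreducible_generator :: "real ^ 'n ^ 'n \<Rightarrow> bool" where
  "irreducible_generator Q \<longleftrightarrow>
     (\<forall>i j. (i, j) \<in> {(k, l). k \<noteq> l \<and> 0 < Q $ k $ l}\<^sup>*)"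

text \<open>
  The library's power and \<open>exp\<close> are not usable here: multiplication on the type \<open>real ^ 'n ^ 'n\<close> is
  componentwise, so the exponential series of the matrix product is spelled out.
\<close>

primrec matrix_power :: "real ^ 'n ^ 'n \<Rightarrow> nat \<Rightarrow> real ^ 'n ^ 'n" where
  "matrix_power A 0 = mat 1"
| "matrix_power A (Suc k) = A ** matrix_power A k"

definition matrix_exp :: "real ^ 'n ^ 'n \<Rightarrow> real ^ 'n ^ 'n" where
  "matrix_exp A = (\<Sum>k. (1 / fact k) *\<^sub>R matrix_power A k)"

lemma summable_matrix_exp:
  fixes A :: "real ^ 'n ^ 'n"
  shows "summable (\<lambda>k. (1 / fact k) *\<^sub>R matrix_power A k)"
proof -
  have "bilinear ((**) :: real ^ 'n ^ 'n \<Rightarrow> real ^ 'n ^ 'n \<Rightarrow> real ^ 'n ^ 'n)"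
    unfolding bilinear_def
    by (auto intro!: linearI
        simp: matrix_matrix_mult_def vec_eq_iff sum.distrib sum_distrib_left distrib_left distrib_right mult_ac)
  then obtain K where K: "K > 0"
    and le: "\<And>B C. norm (B ** (C :: real ^ 'n ^ 'n)) \<le> K * norm (B :: real ^ 'n ^ 'n) * norm C"
    using bilinear_bounded_pos by blast
  have bound: "norm (matrix_power A k) \<le> norm (mat 1 :: real ^ 'n ^ 'n) * (K * norm A) ^ k" for k
  proof (induction k)
    case (Suc k)
    have "norm (matrix_power A (Suc k)) \<le> (K * norm A) * norm (matrix_power A k)"
      using le[of A "matrix_power A k"] by simp
    also have "\<dots> \<le> (K * norm A) * (norm (mat 1 :: real ^ 'n ^ 'n) * (K * norm A) ^ k)"
      using Suc K by (intro mult_left_mono) auto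
    finally show ?case by (simp add: mult_ac)
  qed simp
  show ?thesis
  proof (rule summable_comparison_test')
    show "summable (\<lambda>k. norm (mat 1 :: real ^ 'n ^ 'n) * ((K * norm A) ^ k /\<^sub>R fact k))"
      by (intro summable_mult summable_exp_generic)
    show "norm ((1 / fact k) *\<^sub>R matrix_power A k)
        \<le> norm (mat 1 :: real ^ 'n ^ 'n) * ((K * norm A) ^ k /\<^sub>R fact k)" if "k \<ge> 0" for k
      using mult_left_mono[OF bound[of k], of "1 / fact k"] by (simp add: field_simps)
  qed
qed

definition semigroup_flow :: "real ^ 'n ^ 'n \<Rightarrow> real ^ 'n \<Rightarrow> real \<Rightarrow> real ^ 'n" where
  "semigroup_flow Q \<mu> t = \<mu> v* matrix_exp (t *\<^sub>R Q)"

definition stationary_distribution :: "real ^ 'n ^ 'n \<Rightarrow> real ^ 'n \<Rightarrow> bool" where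
  "stationary_distribution Q \<pi> \<longleftrightarrow>
     (\<forall>i. 0 \<le> \<pi> $ i) \<and> (\<Sum>i\<in>UNIV. \<pi> $ i) = 1 \<and> (\<forall>t\<ge>0. semigroup_flow Q \<pi> t = \<pi>)"

section \<open>The manifold of positive distributions\<close>

definition pos_dists :: "(real ^ 'n) set" where
  "pos_dists = {v. (\<Sum>i\<in>UNIV. v $ i) = 1 \<and> (\<forall>i. 0 < v $ i)}"

definition tangent :: "(real ^ 'n) set" where
  "tangent = {v. (\<Sum>i\<in>UNIV. v $ i) = 0}"

text \<open>
  Functionals on \<^const>\<open>pos_dists\<close> are functions on \<open>real ^ 'n\<close> of which only the values on
  \<^const>\<open>pos_dists\<close> matter. Correspondingly, derivatives are taken within \<^const>\<open>pos_dists\<close>. Such a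
  derivative is a linear map on \<open>real ^ 'n\<close> that is determined only on \<^const>\<open>tangent\<close> (see
  \<open>differential_eq\<close> below), and it is only ever evaluated there.
\<close>

definition differential :: "(real ^ 'n \<Rightarrow> real) \<Rightarrow> real ^ 'n \<Rightarrow> real ^ 'n \<Rightarrow> real" where
  "differential F \<mu> = frechet_derivative F (at \<mu> within pos_dists)"

lemma differential_eq:
  fixes F :: "real ^ 'n \<Rightarrow> real"
  assumes D: "(F has_derivative D) (at \<mu> within pos_dists)"
    and \<mu>: "\<mu> \<in> pos_dists" and v: "v \<in> tangent"
  shows "differential F \<mu> v = D v"
proof -
  define S where "S = {t :: real. \<forall>i. 0 < (\<mu> + t *\<^sub>R v) $ i}"
  have "S = (\<Inter>i. {t. 0 < \<mu> $ i + t * v $ i})"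
    by (auto simp: S_def)
  moreover have "open {t. 0 < \<mu> $ i + t * v $ i}" for i
    by (intro open_Collect_less continuous_intros)
  ultimately have S: "open S" "0 \<in> S"
    using \<mu> by (auto simp: S_def pos_dists_def)
  have sub: "(\<lambda>t. \<mu> + t *\<^sub>R v) ` S \<subseteq> pos_dists"
    using \<mu> v by (auto simp: S_def pos_dists_def tangent_def sum.distrib simp flip: sum_distrib_left)
  have line: "((\<lambda>t. F (\<mu> + t *\<^sub>R v)) has_derivative (\<lambda>t. E (t *\<^sub>R v))) (at 0)"
    if "(F has_derivative E) (at \<mu> within pos_dists)" for E
  proof -
    have "(F has_derivative E) (at (\<mu> + 0 *\<^sub>R v) within (\<lambda>t. \<mu> + t *\<^sub>R v) ` S)"
      using has_derivative_subset[OF that sub] by simp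
    moreover have "((\<lambda>t. \<mu> + t *\<^sub>R v) has_derivative (\<lambda>t. t *\<^sub>R v)) (at 0 within S)"
      by (auto intro!: derivative_eq_intros)
    ultimately have "(F \<circ> (\<lambda>t. \<mu> + t *\<^sub>R v) has_derivative E \<circ> (\<lambda>t. t *\<^sub>R v)) (at 0 within S)"
      by (intro diff_chain_within)
    then show ?thesis
      unfolding at_within_open[OF S(2) S(1)] comp_def .
  qed
  have "(F has_derivative differential F \<mu>) (at \<mu> within pos_dists)"
    unfolding differential_def by (rule iffD1[OF frechet_derivative_works differentiableI[OF D]])
  from fun_cong[OF has_derivative_unique[OF line[OF this] line[OF D]], of 1]
  show ?thesis by simp
qed

primrec Ck_on_pos_dists :: "nat \<Rightarrow> (real ^ 'n \<Rightarrow> real) \<Rightarrow> bool" where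
  "Ck_on_pos_dists 0 f \<longleftrightarrow> continuous_on pos_dists f"
| "Ck_on_pos_dists (Suc k) f \<longleftrightarrow>
     f differentiable_on pos_dists \<and>
     (\<forall>v\<in>tangent. Ck_on_pos_dists k (\<lambda>\<mu>. differential f \<mu> v))"

definition smooth_on_pos_dists :: "(real ^ 'n \<Rightarrow> real) \<Rightarrow> bool" where
  "smooth_on_pos_dists f \<longleftrightarrow> (\<forall>k. Ck_on_pos_dists k f)"

text \<open>
  A metric is a function \<open>g \<mu> u v\<close>; only its values for \<open>\<mu>\<close> in \<^const>\<open>pos_dists\<close> and \<open>u\<close>, \<open>v\<close> in
  \<^const>\<open>tangent\<close> matter. Since every tangent space is \<^const>\<open>tangent\<close>, smoothness of \<open>g\<close> is smoothness
  of its coefficients in constant directions.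
\<close>

definition inner_product_on_tangent :: "(real ^ 'n \<Rightarrow> real ^ 'n \<Rightarrow> real) \<Rightarrow> bool" where
  "inner_product_on_tangent h \<longleftrightarrow>
     (\<forall>u\<in>tangent. \<forall>v\<in>tangent. h u v = h v u) \<and>
     (\<forall>u\<in>tangent. \<forall>v\<in>tangent. \<forall>w\<in>tangent. \<forall>a b.
        h (a *\<^sub>R u + b *\<^sub>R v) w = a * h u w + b * h v w) \<and>
     (\<forall>u\<in>tangent. u \<noteq> 0 \<longrightarrow> 0 < h u u)"

definition riemannian_metric :: "(real ^ 'n \<Rightarrow> real ^ 'n \<Rightarrow> real ^ 'n \<Rightarrow> real) \<Rightarrow> bool" where
  "riemannian_metric g \<longleftrightarrow>
     (\<forall>\<mu>\<in>pos_dists. inner_product_on_tangent (g \<mu>)) \<and>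
     (\<forall>u\<in>tangent. \<forall>v\<in>tangent. smooth_on_pos_dists (\<lambda>\<mu>. g \<mu> u v))"

section \<open>Gradient flows\<close>

text \<open>At time \<open>0\<close> the time derivative is the one-sided derivative.\<close>

definition is_gradient_flow ::
  "(real ^ 'n \<Rightarrow> real) \<Rightarrow> (real ^ 'n \<Rightarrow> real ^ 'n \<Rightarrow> real ^ 'n \<Rightarrow> real) \<Rightarrow> (real \<Rightarrow> real ^ 'n) \<Rightarrow> bool"
  where
  "is_gradient_flow F g \<rho> \<longleftrightarrow>
     (\<forall>t\<ge>0. \<rho> t \<in> pos_dists) \<and>
     (\<forall>t\<ge>0. \<exists>\<rho>'\<in>tangent. (\<rho> has_vector_derivative \<rho>') (at t within {0..}) \<and>
        (\<forall>v\<in>tangent. g (\<rho> t) \<rho>' v = - differential F (\<rho> t) v))"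

text \<open>
  The equivalence expresses that the trajectory of the semigroup is \<^emph>\<open>the\<close> gradient flow started
  at \<open>\<mu>\<close>: it is a gradient flow, and every gradient flow started at \<open>\<mu>\<close> coincides with it for all
  nonnegative times.
\<close>

definition gradient_flow_equals_semigroup ::
  "(real ^ 'n \<Rightarrow> real) \<Rightarrow> (real ^ 'n \<Rightarrow> real ^ 'n \<Rightarrow> real ^ 'n \<Rightarrow> real) \<Rightarrow> real ^ 'n ^ 'n \<Rightarrow> bool"
  where
  "gradient_flow_equals_semigroup F g Q \<longleftrightarrow>
     (\<forall>\<mu>\<in>pos_dists. \<forall>\<rho>.
        is_gradient_flow F g \<rho> \<and> \<rho> 0 = \<mu> \<longleftrightarrow> (\<forall>t\<ge>0. \<rho> t = semigroup_flow Q \<mu> t))"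

end

theory Submission
  imports Defs
begin

text \<open>
  A gradient flow only tests its metric against the velocity of the flow. If the semigroup is the gradient
  flow of \<open>F\<close> under \<open>g\<close>, then looking at time \<open>0\<close> from every starting point shows that the velocity
  field \<open>W \<mu> = \<mu> Q\<close> is the negative gradient of \<open>F\<close>, that is
  \<open>g \<mu> (W \<mu>) v = - differential F \<mu> v\<close> for all tangent \<open>v\<close>
  (\<open>neg_gradient_field_of_semigroup\<close>). Conversely the gradient flows of any metric with this property are
  exactly the integral curves of \<open>W\<close> (\<open>is_gradient_flow_iff_integral_curve\<close>). Hence the metric may be
  altered freely as long as its pairing with \<open>W\<close> is kept.

  The alteration adds the positive semidefinite form
  \<open>(w \<bullet> w) * (u \<bullet> v) - (u \<bullet> w) * (v \<bullet> w)\<close> with \<open>w = W \<mu>\<close>. It annihilates \<open>w\<close>, so the negative gradient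
  is unchanged; it is polynomial in \<open>\<mu>\<close>, so the new metric is smooth; and it vanishes only on multiples
  of \<open>w\<close> when \<open>w \<noteq> 0\<close>. As the tangent space has dimension \<open>d \<ge> 2\<close>, it therefore changes the metric
  wherever \<open>W\<close> does not vanish. By irreducibility the only zero of \<open>W\<close> among positive distributions
  is \<open>\<pi>\<close> (\<open>equilibrium_unique\<close>).
\<close>

section \<open>Smooth functions on the positive distributions\<close>

lemma differential_cong:
  assumes "\<And>\<nu>. \<nu> \<in> pos_dists \<Longrightarrow> f \<nu> = f' \<nu>" and "\<mu> \<in> pos_dists"
  shows "differential f \<mu> = differential f' \<mu>"
proof -
  have "(f has_derivative D) (at \<mu> within pos_dists) \<longleftrightarrow> (f' has_derivative D) (at \<mu> within pos_dists)" for D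
    using assms by (intro iffI; elim has_derivative_transform[rotated 2]) auto
  then show ?thesis
    unfolding differential_def frechet_derivative_def by simp
qed

lemma Ck_on_pos_dists_cong:
  assumes "\<And>\<mu>. \<mu> \<in> pos_dists \<Longrightarrow> f \<mu> = f' \<mu>"
  shows "Ck_on_pos_dists k f \<longleftrightarrow> Ck_on_pos_dists k f'"
  using assms
proof (induction k arbitrary: f f')
  case 0
  then show ?case by (simp cong: continuous_on_cong)
next
  case (Suc k)
  have "f differentiable_on pos_dists \<longleftrightarrow> f' differentiable_on pos_dists"
    using Suc.prems unfolding differentiable_on_def
    by (metis differentiable_transform_within zero_less_one)
  moreover have "Ck_on_pos_dists k (\<lambda>\<mu>. differential f \<mu> v) \<longleftrightarrow> Ck_on_pos_dists k (\<lambda>\<mu>. differential f' \<mu> v)" for v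
    using Suc.prems by (intro Suc.IH) (simp add: differential_cong[of f f'])
  ultimately show ?case by simp
qed

lemma Ck_on_pos_dists_add:
  assumes "Ck_on_pos_dists k f" and "Ck_on_pos_dists k f'"
  shows "Ck_on_pos_dists k (\<lambda>\<mu>. f \<mu> + f' \<mu>)"
  using assms
proof (induction k arbitrary: f f')
  case 0
  then show ?case by (simp add: continuous_on_add)
next
  case (Suc k)
  have "Ck_on_pos_dists k (\<lambda>\<mu>. differential (\<lambda>\<mu>. f \<mu> + f' \<mu>) \<mu> v)" if v: "v \<in> tangent" for v
  proof -
    have "differential (\<lambda>\<mu>. f \<mu> + f' \<mu>) \<mu> v = differential f \<mu> v + differential f' \<mu> v"
      if \<mu>: "\<mu> \<in> pos_dists" for \<mu>
    proof (rule differential_eq[OF _ \<mu> v])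
      have "(f has_derivative differential f \<mu>) (at \<mu> within pos_dists)"
        and "(f' has_derivative differential f' \<mu>) (at \<mu> within pos_dists)"
        using Suc.prems \<mu> by (auto simp: differential_def differentiable_on_def frechet_derivative_works)
      then show "((\<lambda>\<mu>. f \<mu> + f' \<mu>) has_derivative (\<lambda>v. differential f \<mu> v + differential f' \<mu> v))
          (at \<mu> within pos_dists)"
        by (rule has_derivative_add)
    qed
    moreover have "Ck_on_pos_dists k (\<lambda>\<mu>. differential f \<mu> v + differential f' \<mu> v)"
      using Suc v by simp
    ultimately show ?thesis
      by (simp cong: Ck_on_pos_dists_cong)
  qed
  then show ?case
    using Suc.prems by (simp add: differentiable_on_def)
qed

text \<open>
  Polynomials are closed under directional derivatives, which is what the recursion on the order of
  differentiability asks for.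
\<close>

lemma real_polynomial_function_has_derivative:
  fixes p :: "'a::euclidean_space \<Rightarrow> real"
  assumes "real_polynomial_function p"
  obtains p' where "\<And>x. (p has_derivative p' x) (at x)"
    and "\<And>v. real_polynomial_function (\<lambda>x. p' x v)"
proof -
  have "\<exists>p'. (\<forall>x. (p has_derivative p' x) (at x)) \<and> (\<forall>v. real_polynomial_function (\<lambda>x. p' x v))"
    using assms
  proof induction
    case (linear f)
    then have "(f has_derivative f) (at x)" for x
      by (rule bounded_linear_imp_has_derivative)
    then show ?case
      by (intro exI[of _ "\<lambda>_. f"]) (auto intro: real_polynomial_function.intros)
  next
    case (const c)
    show ?case
      by (intro exI[of _ "\<lambda>_ _. 0"]) (auto intro: real_polynomial_function.intros)
  next
    case (add f h)
    then obtain f' h' where "\<And>x. (f has_derivative f' x) (at x)" "\<And>x. (h has_derivative h' x) (at x)"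
      "\<And>v. real_polynomial_function (\<lambda>x. f' x v)" "\<And>v. real_polynomial_function (\<lambda>x. h' x v)"
      by blast
    then show ?case
      by (intro exI[of _ "\<lambda>x v. f' x v + h' x v"])
        (auto intro: has_derivative_add real_polynomial_function.intros)
  next
    case (mult f h)
    then obtain f' h' where "\<And>x. (f has_derivative f' x) (at x)" "\<And>x. (h has_derivative h' x) (at x)"
      "\<And>v. real_polynomial_function (\<lambda>x. f' x v)" "\<And>v. real_polynomial_function (\<lambda>x. h' x v)"
      by blast
    then show ?case
      using mult.hyps
      by (intro exI[of _ "\<lambda>x v. f x * h' x v + f' x v * h x"])
        (intro allI conjI has_derivative_mult real_polynomial_function.intros(3,4))
  qed
  then show thesis using that by blast
qed

lemma smooth_on_pos_dists_polynomial:
  fixes p :: "real ^ 'n \<Rightarrow> real"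
  assumes "real_polynomial_function p"
  shows "smooth_on_pos_dists p"
proof -
  have "Ck_on_pos_dists k p" for k
    using assms
  proof (induction k arbitrary: p)
    case 0
    then show ?case
      by (simp add: continuous_on_polymonial_function real_polynomial_function_eq)
  next
    case (Suc k)
    obtain p' where p': "\<And>x. (p has_derivative p' x) (at x)"
      "\<And>v. real_polynomial_function (\<lambda>x. p' x v)"
      using real_polynomial_function_has_derivative[OF Suc.prems] by blast
    have D: "(p has_derivative p' x) (at x within pos_dists)" for x
      by (rule has_derivative_at_withinI[OF p'(1)])
    have "Ck_on_pos_dists k (\<lambda>\<mu>. differential p \<mu> v)" if "v \<in> tangent" for v
      using Suc.IH[OF p'(2)[of v]] differential_eq[OF D _ that] by (simp cong: Ck_on_pos_dists_cong)
    moreover have "p differentiable_on pos_dists"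
      using D by (auto simp: differentiable_on_def differentiable_def)
    ultimately show ?case by simp
  qed
  then show ?thesis by (simp add: smooth_on_pos_dists_def)
qed

section \<open>The velocity field of the semigroup\<close>

lemma matrix_power_scaleR: "matrix_power (t *\<^sub>R A) k = t ^ k *\<^sub>R matrix_power A k"
  by (induction k) (simp_all add: matrix_scalar_ac scalar_matrix_assoc mult.commute)

text \<open>
  Each entry of \<open>exp (t Q)\<close> is an everywhere convergent power series in \<open>t\<close> whose linear coefficient
  is the corresponding entry of \<open>Q\<close>.
\<close>

lemma semigroup_flow_has_vector_derivative_0:
  "(semigroup_flow Q \<mu> has_vector_derivative \<mu> v* Q) (at 0 within S)"
proof -
  have entry: "((\<lambda>t. matrix_exp (t *\<^sub>R Q) $ i $ j) has_real_derivative Q $ i $ j) (at 0)" for i j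
  proof -
    let ?c = "\<lambda>k. matrix_power Q k $ i $ j / fact k"
    have sums: "(\<lambda>k. ?c k * t ^ k) sums (matrix_exp (t *\<^sub>R Q) $ i $ j)" for t
    proof -
      have "(\<lambda>k. (1 / fact k) *\<^sub>R matrix_power (t *\<^sub>R Q) k) sums matrix_exp (t *\<^sub>R Q)"
        unfolding matrix_exp_def by (rule summable_sums[OF summable_matrix_exp])
      then have "(\<lambda>k. ((1 / fact k) *\<^sub>R matrix_power (t *\<^sub>R Q) k) $ i $ j) sums (matrix_exp (t *\<^sub>R Q) $ i $ j)"
        by (intro bounded_linear.sums[OF bounded_linear_vec_nth])
      then show ?thesis by (simp add: matrix_power_scaleR mult_ac)
    qed
    have "((\<lambda>t. \<Sum>k. ?c k * t ^ k) has_real_derivative (\<Sum>k. diffs ?c k * 0 ^ k)) (at 0)"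
      by (rule termdiffs_strong_converges_everywhere) (rule sums_summable[OF sums])
    moreover have "(\<Sum>k. diffs ?c k * 0 ^ k) = Q $ i $ j"
      using powser_zero[of "diffs ?c"] by (simp add: diffs_def)
    ultimately show ?thesis
      by (simp add: sums_unique[OF sums])
  qed
  have "((\<lambda>t. semigroup_flow Q \<mu> t $ j) has_real_derivative (\<mu> v* Q) $ j) (at 0 within S)" for j
    unfolding semigroup_flow_def vector_matrix_mult_def vec_lambda_beta
    by (rule DERIV_sum) (rule DERIV_cmult[OF has_field_derivative_at_within[OF entry]])
  then have "((\<lambda>t. \<chi> j. semigroup_flow Q \<mu> t $ j) has_vector_derivative (\<chi> j. (\<mu> v* Q) $ j)) (at 0 within S)"
    unfolding has_vector_derivative_def has_field_derivative_def
    by (subst has_derivative_componentwise_within)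
      (auto simp: Basis_vec_def inner_axis mult.commute[of _ "_ $ _"])
  then show ?thesis by simp
qed

lemma vector_derivative_unique_halfline:
  fixes t :: real
  assumes "(f has_vector_derivative a) (at t within {0..})"
    and "(f has_vector_derivative b) (at t within {0..})" and "t \<ge> 0"
  shows "a = b"
proof (rule vector_derivative_unique_within[OF _ assms(1,2)])
  have "at t within {t..} \<le> at t within {0..}"
    using \<open>t \<ge> 0\<close> by (intro at_le) auto
  moreover have "at t within {t..} \<noteq> bot"
    by (simp add: at_within_Ici_at_right)
  ultimately show "at t within {0..} \<noteq> bot"
    by (metis bot.extremum_uniqueI)
qed

lemma stationary_distribution_velocity:
  assumes "stationary_distribution Q \<pi>"
  shows "\<pi> v* Q = 0"
proof (rule vector_derivative_unique_halfline[of "\<lambda>_. \<pi>" _ 0])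
  show "((\<lambda>_. \<pi>) has_vector_derivative \<pi> v* Q) (at 0 within {0..})"
  proof (rule has_vector_derivative_transform[OF _ _ semigroup_flow_has_vector_derivative_0])
    show "\<pi> = semigroup_flow Q \<pi> t" if "t \<in> {0..}" for t
      using that assms by (simp add: stationary_distribution_def)
  qed simp
qed simp_all

text \<open>
  Subtract from \<open>\<nu>\<close> the largest multiple of \<open>\<mu>\<close> that keeps all entries nonnegative. The difference is
  an equilibrium with a vanishing entry, and vanishing spreads backwards along transitions because no mass
  may flow into an empty state.
\<close>

lemma equilibrium_unique:
  fixes Q :: "real ^ 'n ^ 'n"
  assumes gen: "generator Q" and irr: "irreducible_generator Q"
    and \<mu>: "\<And>i. 0 < \<mu> $ i" "(\<Sum>i\<in>UNIV. \<mu> $ i) = 1" "\<mu> v* Q = 0"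
    and \<nu>: "(\<Sum>i\<in>UNIV. \<nu> $ i) = 1" "\<nu> v* Q = 0"
  shows "\<nu> = \<mu>"
proof -
  define m where "m = Min (range (\<lambda>i. \<nu> $ i / \<mu> $ i))"
  have "m \<in> range (\<lambda>i. \<nu> $ i / \<mu> $ i)"
    unfolding m_def by (intro Min_in) auto
  then obtain a where a: "m = \<nu> $ a / \<mu> $ a" by blast
  define y where "y = \<nu> - m *\<^sub>R \<mu>"
  have nonneg: "0 \<le> y $ i" for i
  proof -
    have "m \<le> \<nu> $ i / \<mu> $ i" unfolding m_def by (intro Min_le) auto
    then show ?thesis using \<mu>(1)[of i] by (simp add: y_def field_simps)
  qed
  have ya: "y $ a = 0"
    using \<mu>(1)[of a] by (simp add: y_def a)
  have yQ: "(\<Sum>i\<in>UNIV. y $ i * Q $ i $ j) = 0" for j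
  proof -
    have "(\<Sum>i\<in>UNIV. y $ i * Q $ i $ j) = (\<nu> v* Q) $ j - m * (\<mu> v* Q) $ j"
      by (simp add: y_def vector_matrix_mult_def algebra_simps sum_subtractf sum_distrib_left)
    then show ?thesis using \<mu>(3) \<nu>(2) by simp
  qed
  have zero_pred: "y $ i = 0" if "0 < Q $ i $ j" "i \<noteq> j" "y $ j = 0" for i j
  proof -
    have "(\<Sum>k\<in>UNIV - {j}. y $ k * Q $ k $ j) = 0"
      using yQ[of j] \<open>y $ j = 0\<close> by (simp add: sum.remove[of UNIV j])
    then have "y $ i * Q $ i $ j = 0"
      using \<open>i \<noteq> j\<close> gen nonneg
      by (subst (asm) sum_nonneg_eq_0_iff) (auto simp: generator_def)
    then show ?thesis using that by simp
  qed
  have "y $ i = 0" for i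
  proof -
    have "(i, a) \<in> {(k, l). k \<noteq> l \<and> 0 < Q $ k $ l}\<^sup>*"
      using irr by (simp add: irreducible_generator_def)
    then show ?thesis
      by (induction rule: converse_rtrancl_induct) (auto simp: ya zero_pred)
  qed
  then have eq: "\<nu> $ i = m * \<mu> $ i" for i
    by (simp add: y_def)
  then have "1 = m * 1"
    using \<mu>(2) \<nu>(1) by (simp flip: sum_distrib_left)
  then show ?thesis using eq by (simp add: vec_eq_iff)
qed

section \<open>Gradient flows as integral curves\<close>

lemma inner_product_on_tangent_eqI:
  assumes h: "inner_product_on_tangent h" and a: "a \<in> tangent" and b: "b \<in> tangent"
    and eq: "\<And>v. v \<in> tangent \<Longrightarrow> h a v = h b v"
  shows "a = b"
proof (rule ccontr)
  assume "a \<noteq> b"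
  have ab: "a - b \<in> tangent"
    using a b by (simp add: tangent_def sum_subtractf)
  have "h (1 *\<^sub>R a + (-1) *\<^sub>R b) (a - b) = 1 * h a (a - b) + (-1) * h b (a - b)"
    using h a b ab unfolding inner_product_on_tangent_def by blast
  then have "h (a - b) (a - b) = 0"
    using eq[OF ab] by simp
  moreover have "0 < h (a - b) (a - b)"
    using h ab \<open>a \<noteq> b\<close> unfolding inner_product_on_tangent_def by simp
  ultimately show False by simp
qed

definition is_neg_gradient_field ::
  "(real ^ 'n \<Rightarrow> real) \<Rightarrow> (real ^ 'n \<Rightarrow> real ^ 'n \<Rightarrow> real ^ 'n \<Rightarrow> real) \<Rightarrow> (real ^ 'n \<Rightarrow> real ^ 'n) \<Rightarrow> bool"
  where
  "is_neg_gradient_field F g W \<longleftrightarrow>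
     (\<forall>\<mu>\<in>pos_dists. W \<mu> \<in> tangent \<and> (\<forall>v\<in>tangent. g \<mu> (W \<mu>) v = - differential F \<mu> v))"

text \<open>
  By nondegeneracy of the metric, the gradient flow only sees the negative gradient field: two metrics
  with the same negative gradient field have the same gradient flows.
\<close>

lemma is_gradient_flow_iff_integral_curve:
  assumes g: "riemannian_metric g" and W: "is_neg_gradient_field F g W"
  shows "is_gradient_flow F g \<rho> \<longleftrightarrow>
    (\<forall>t\<ge>0. \<rho> t \<in> pos_dists \<and> (\<rho> has_vector_derivative W (\<rho> t)) (at t within {0..}))"
proof -
  have "x = W \<mu>" if "\<mu> \<in> pos_dists" "x \<in> tangent" "\<forall>v\<in>tangent. g \<mu> x v = - differential F \<mu> v" for \<mu> x
    by (rule inner_product_on_tangent_eqI[of "g \<mu>"])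
      (use that g W in \<open>auto simp: riemannian_metric_def is_neg_gradient_field_def\<close>)
  then show ?thesis
    using W unfolding is_gradient_flow_def is_neg_gradient_field_def by blast
qed

text \<open>
  Every positive distribution is the starting point of a semigroup trajectory, so the gradient flow
  equation at time \<open>0\<close> already determines the gradient everywhere.
\<close>

lemma neg_gradient_field_of_semigroup:
  fixes Q :: "real ^ 'n ^ 'n"
  assumes "gradient_flow_equals_semigroup F g Q"
  shows "is_neg_gradient_field F g (\<lambda>\<mu>. \<mu> v* Q)"
  unfolding is_neg_gradient_field_def
proof
  fix \<mu> :: "real ^ 'n"
  assume \<mu>: "\<mu> \<in> pos_dists"
  let ?\<rho> = "semigroup_flow Q \<mu>"
  have "is_gradient_flow F g ?\<rho>" and start: "?\<rho> 0 = \<mu>"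
    using assms \<mu> unfolding gradient_flow_equals_semigroup_def by blast+
  then obtain x where x: "x \<in> tangent" "(?\<rho> has_vector_derivative x) (at 0 within {0..})"
    "\<forall>v\<in>tangent. g \<mu> x v = - differential F \<mu> v"
    unfolding is_gradient_flow_def by force
  moreover have "x = \<mu> v* Q"
    using vector_derivative_unique_halfline[OF x(2) semigroup_flow_has_vector_derivative_0] by simp
  ultimately show "\<mu> v* Q \<in> tangent \<and> (\<forall>v\<in>tangent. g \<mu> (\<mu> v* Q) v = - differential F \<mu> v)"
    by simp
qed

section \<open>Changing the metric transversally to the velocity\<close>

text \<open>
  The polarised Gram determinant of \<open>w\<close> with a second vector: up to the factor \<open>(norm w)\<^sup>2\<close> it is the
  Euclidean inner product of the components orthogonal to \<open>w\<close>. Compared with the orthogonal projection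
  itself, it avoids a division and so remains smooth where \<open>w\<close> vanishes.
\<close>

definition gram_form :: "'a::real_inner \<Rightarrow> 'a \<Rightarrow> 'a \<Rightarrow> real" where
  "gram_form w u v = (w \<bullet> w) * (u \<bullet> v) - (u \<bullet> w) * (v \<bullet> w)"

lemma gram_form_commute: "gram_form w u v = gram_form w v u"
  by (simp add: gram_form_def inner_commute)

lemma gram_form_linear:
  "gram_form w (a *\<^sub>R u + b *\<^sub>R v) x = a * gram_form w u x + b * gram_form w v x"
  by (simp add: gram_form_def algebra_simps)

lemma gram_form_self: "gram_form w w v = 0"
  by (simp add: gram_form_def inner_commute)

lemma gram_form_nonneg: "0 \<le> gram_form w u u"
  using Cauchy_Schwarz_ineq[of u w] by (simp add: gram_form_def power2_eq_square mult.commute)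

lemma real_polynomial_function_gram_form:
  fixes Q :: "real ^ 'n ^ 'n"
  shows "real_polynomial_function (\<lambda>\<mu>. gram_form (\<mu> v* Q) u v)"
proof -
  have "linear (\<lambda>\<mu>. \<mu> v* Q)"
    by (auto intro!: linearI simp: vector_matrix_mult_def vec_eq_iff sum.distrib sum_distrib_left algebra_simps)
  then have lin: "bounded_linear (\<lambda>\<mu>. (\<mu> v* Q) \<bullet> x)" for x
    by (intro bounded_linear_compose[OF bounded_linear_inner_left] linear_conv_bounded_linear[THEN iffD1])
  have "gram_form (\<mu> v* Q) u v
      = (\<Sum>b\<in>Basis. ((\<mu> v* Q) \<bullet> b) * ((\<mu> v* Q) \<bullet> b)) * (u \<bullet> v)
        + (- 1) * (((\<mu> v* Q) \<bullet> u) * ((\<mu> v* Q) \<bullet> v))" for \<mu>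
    by (simp add: gram_form_def euclidean_inner[of "\<mu> v* Q" "\<mu> v* Q"] inner_commute)
  then show ?thesis
    by (simp only:) (intro real_polynomial_function.intros real_polynomial_function_sum lin finite_Basis)
qed

lemma riemannian_metric_add_gram_form:
  fixes Q :: "real ^ 'n ^ 'n"
  assumes g: "riemannian_metric g"
  shows "riemannian_metric (\<lambda>\<mu> u v. g \<mu> u v + gram_form (\<mu> v* Q) u v)"
  unfolding riemannian_metric_def
proof (intro conjI ballI)
  fix \<mu> :: "real ^ 'n" assume "\<mu> \<in> pos_dists"
  then have "inner_product_on_tangent (g \<mu>)"
    using g by (simp add: riemannian_metric_def)
  then show "inner_product_on_tangent (\<lambda>u v. g \<mu> u v + gram_form (\<mu> v* Q) u v)"
    unfolding inner_product_on_tangent_def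
    by (auto simp: gram_form_linear gram_form_nonneg add_pos_nonneg algebra_simps intro: gram_form_commute)
next
  fix u v :: "real ^ 'n" assume "u \<in> tangent" "v \<in> tangent"
  then show "smooth_on_pos_dists (\<lambda>\<mu>. g \<mu> u v + gram_form (\<mu> v* Q) u v)"
    using g smooth_on_pos_dists_polynomial[OF real_polynomial_function_gram_form]
    unfolding riemannian_metric_def smooth_on_pos_dists_def
    by (intro allI Ck_on_pos_dists_add) auto
qed

lemma exists_tangent_gram_form_pos:
  fixes w :: "real ^ 'n"
  assumes "3 \<le> CARD('n)" and "w \<noteq> 0"
  obtains u where "u \<in> tangent" and "0 < gram_form w u u"
proof -
  \<comment> \<open>The tangent space is the orthogonal complement of \<open>1\<close>, and \<open>1\<close>, \<open>w\<close> do not span the space.\<close>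
  have "dim {1, w} \<le> card {1, w}"
    by (intro dim_le_card') simp
  also have "card {1, w} \<le> 2"
    by (simp add: card_insert_if)
  finally have "dim {1, w} < DIM(real ^ 'n)"
    using assms(1) by simp
  then obtain u where "u \<noteq> 0" and u: "\<And>y. y \<in> span {1, w} \<Longrightarrow> orthogonal u y"
    using orthogonal_to_subspace_exists by blast
  have "u \<bullet> 1 = 0" "u \<bullet> w = 0"
    using u[of 1] u[of w] by (auto simp: orthogonal_def span_base)
  then have "u \<in> tangent" "gram_form w u u = (w \<bullet> w) * (u \<bullet> u)"
    by (auto simp: tangent_def inner_vec_def gram_form_def)
  then show thesis
    using that \<open>u \<noteq> 0\<close> \<open>w \<noteq> 0\<close> by simp
qed

section \<open>Non-uniqueness of the metric\<close>

theorem theorem1p1: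
  fixes d :: nat
    and Q :: "real ^ 'n ^ 'n"
    and \<pi> :: "real ^ 'n"
    and F :: "real ^ 'n \<Rightarrow> real"
    and g :: "real ^ 'n \<Rightarrow> real ^ 'n \<Rightarrow> real ^ 'n \<Rightarrow> real"
    and \<rho> :: "real ^ 'n"
  assumes "2 \<le> d" and "CARD('n) = d + 1"
    and "generator Q" and "irreducible_generator Q"
    and "stationary_distribution Q \<pi>"
    and "F differentiable_on pos_dists"
    and "riemannian_metric g"
    and "gradient_flow_equals_semigroup F g Q"
    and "\<rho> \<in> pos_dists" and "\<rho> \<noteq> \<pi>"
  shows "\<exists>g'. riemannian_metric g' \<and>
    (\<exists>u\<in>tangent. \<exists>v\<in>tangent. g' \<rho> u v \<noteq> g \<rho> u v) \<and>
    gradient_flow_equals_semigroup F g' Q"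
proof (intro exI conjI)
  let ?W = "\<lambda>\<mu>. \<mu> v* Q"
  let ?g' = "\<lambda>\<mu> u v. g \<mu> u v + gram_form (?W \<mu>) u v"
  show metric: "riemannian_metric ?g'"
    using assms(7) by (rule riemannian_metric_add_gram_form)
  have "?W \<rho> \<noteq> 0"
    using equilibrium_unique[OF assms(3,4), of \<rho> \<pi>] stationary_distribution_velocity[OF assms(5)] assms(5,9,10)
    by (auto simp: pos_dists_def stationary_distribution_def)
  then obtain u where "u \<in> tangent" "0 < gram_form (?W \<rho>) u u"
    using exists_tangent_gram_form_pos[of "?W \<rho>"] assms(1,2) by auto
  then show "\<exists>u\<in>tangent. \<exists>v\<in>tangent. ?g' \<rho> u v \<noteq> g \<rho> u v"
    by (intro bexI[of _ u]) auto
  have W: "is_neg_gradient_field F g ?W"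
    using assms(8) by (rule neg_gradient_field_of_semigroup)
  then have W': "is_neg_gradient_field F ?g' ?W"
    by (simp add: is_neg_gradient_field_def gram_form_self)
  have "is_gradient_flow F ?g' = is_gradient_flow F g"
    by (intro ext) (simp only: is_gradient_flow_iff_integral_curve[OF metric W']
        is_gradient_flow_iff_integral_curve[OF assms(7) W])
  then show "gradient_flow_equals_semigroup F ?g' Q"
    using assms(8) by (simp add: gradient_flow_equals_semigroup_def)
qed

end
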